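(* Let $k \ge 2$, $n\ge 1$ and let $\mathcal{A} = (a_{i_1\cdots i_k})$ be a $k$th order $n$-dimensional symmetric nonnegative tensor. Let $\lambda_{\max}(\mathcal{A})$ denote the largest H-eigenvalue of $\mathcal{A}$. Then $$\lambda_{\max}(\mathcal{A}) = \max \Big\{ \mathcal{A} x^k : x \in \mathbb{R}^n_+,\ \sum_{i=1}^n x_i^k = 1 \Big\}.$$
   Context: A real $k$th order $n$-dimensional tensor is an array $\mathcal{A}=(a_{i_1\cdots i_k})$ of real numbers, $i_1,\dots,i_k\in\{1,\dots,n\}$. It is symmetric if its entries are invariant under every permutation of the indices, and nonnegative if all its entries are nonnegative. For a vector $x$, $\mathcal{A}x^k = \sum_{i_1,\dots,i_k=1}^n a_{i_1\cdots i_k}x_{i_1}\cdots x_{i_k}$; $\mathcal{A}x^{k-1}$ is the $n$-dimensional vector with $i$th component $(\mathcal{A}x^{k-1})_i=\sum_{i_2,\dots,i_k=1}^n a_{ii_2\cdots i_k}x_{i_2}\cdots x_{i_k}$; and $x^{[k-1]}$ is the vector with $i$th component $x_i^{k-1}$. A real number $\lambda$ is an H-eigenvalue of $\mathcal{A}$ if there is a real nonzero vector $x\in\mathbb{R}^n$ (a corresponding H-eigenvector) with $\mathcal{A}x^{k-1}=\lambda x^{[k-1]}$. (A nonnegative tensor always has a largest H-eigenvalue, by the known Perron–Frobenius theorem for nonnegative tensors.) $\mathbb{R}^n_+$ is the set of vectors in $\mathbb{R}^n$ with all components nonnegative. *)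

theory Defs
  imports "HOL-Analysis.Analysis" "HOL-Combinatorics.Permutations"
begin

text \<open>A \<open>k\<close>th order tensor of dimension \<open>CARD('n)\<close> is a function on index lists
  \<open>[i\<^sub>1, \<dots>, i\<^sub>k]\<close>. Only its values on lists of length \<open>k\<close> are entries of the tensor;
  every definition below ignores its values on other lists.\<close>

type_synonym 'n tensor = "'n list \<Rightarrow> real"

definition symmetric_tensor :: "nat \<Rightarrow> 'n tensor \<Rightarrow> bool" where
  "symmetric_tensor k A \<longleftrightarrow>
     (\<forall>is \<sigma>. length is = k \<longrightarrow> \<sigma> permutes {..<k} \<longrightarrow> A (permute_list \<sigma> is) = A is)"

definition nonneg_tensor :: "nat \<Rightarrow> 'n tensor \<Rightarrow> bool" where
  "nonneg_tensor k A \<longleftrightarrow> (\<forall>is. length is = k \<longrightarrow> 0 \<le> A is)"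

definition tensor_form :: "nat \<Rightarrow> 'n::finite tensor \<Rightarrow> real ^ 'n \<Rightarrow> real" where
  "tensor_form k A x = (\<Sum>is | length is = k. A is * (\<Prod>i\<leftarrow>is. x $ i))"

definition tensor_apply :: "nat \<Rightarrow> 'n::finite tensor \<Rightarrow> real ^ 'n \<Rightarrow> real ^ 'n" where
  "tensor_apply k A x =
     (\<chi> i. \<Sum>is | length is = k - 1. A (i # is) * (\<Prod>j\<leftarrow>is. x $ j))"

definition vec_power :: "real ^ 'n \<Rightarrow> nat \<Rightarrow> real ^ 'n" where
  "vec_power x m = (\<chi> i. (x $ i) ^ m)"

definition H_eigenvalue :: "nat \<Rightarrow> 'n::finite tensor \<Rightarrow> real \<Rightarrow> bool" where
  "H_eigenvalue k A \<mu> \<longleftrightarrow>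
     (\<exists>x. x \<noteq> 0 \<and> tensor_apply k A x = \<mu> *\<^sub>R vec_power x (k - 1))"

text \<open>\<open>Max\<close> is meaningful only for finite sets, so attained maxima of arbitrary
  sets of reals are expressed by a predicate.\<close>

definition is_maximum :: "real set \<Rightarrow> real \<Rightarrow> bool" where
  "is_maximum S m \<longleftrightarrow> m \<in> S \<and> (\<forall>s\<in>S. s \<le> m)"

text \<open>\<open>GREATEST\<close> is a definite description: the value is meaningful only if a
  largest H-eigenvalue exists.\<close>

definition lambda_max :: "nat \<Rightarrow> 'n::finite tensor \<Rightarrow> real" where
  "lambda_max k A = (GREATEST \<mu>. H_eigenvalue k A \<mu>)"

end

theory Submission
  imports Defs
begin

text \<open>Let \<open>M\<close> be the maximum of \<open>Ax\<^sup>k\<close> over the nonnegative part of the unit sphere of the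
  \<open>k\<close>-norm, so that \<open>Ay\<^sup>k \<le> M \<Sum>\<^sub>i y\<^sub>i\<^sup>k\<close> for all \<open>y \<ge> 0\<close> by homogeneity. If \<open>\<mu>\<close> is an
  H-eigenvalue with eigenvector \<open>x\<close>, taking absolute values in the \<open>i\<close>th eigenvalue
  equation, multiplying by \<open>\<bar>x\<^sub>i\<bar>\<close> and summing gives \<open>\<mu> \<Sum>\<^sub>i \<bar>x\<^sub>i\<bar>\<^sup>k \<le> A\<bar>x\<bar>\<^sup>k\<close>, hence \<open>\<mu> \<le> M\<close>.
  Conversely, a maximizer \<open>x\<close> is an eigenvector for \<open>M\<close>: the function
  \<open>t \<mapsto> A(x + t e\<^sub>i)\<^sup>k - M \<Sum>\<^sub>j (x + t e\<^sub>i)\<^sub>j\<^sup>k\<close> is maximal at \<open>t = 0\<close> among all \<open>t \<ge> -x\<^sub>i\<close>.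
  Its derivative \<open>k ((Ax\<^sup>k\<^sup>-\<^sup>1)\<^sub>i - M x\<^sub>i\<^sup>k\<^sup>-\<^sup>1)\<close> at \<open>0\<close> therefore vanishes if \<open>x\<^sub>i > 0\<close>.
  If \<open>x\<^sub>i = 0\<close>, it is nonpositive, so \<open>(Ax\<^sup>k\<^sup>-\<^sup>1)\<^sub>i \<le> 0\<close> because \<open>k \<ge> 2\<close>, and equality holds
  because \<open>A\<close> is nonnegative.\<close>

section \<open>Tensors obtained by fixing the first index\<close>

text \<open>Equal multisets differ by a permutation of positions, so later symmetry arguments need
  no explicit permutation.\<close>

lemma symmetric_tensor_mset:
  assumes "symmetric_tensor k A" "length xs = k" "mset xs = mset ys"
  shows "A xs = A ys"
proof -
  obtain \<sigma> where "\<sigma> permutes {..<length ys}" "permute_list \<sigma> ys = xs"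
    using mset_eq_permutation[OF assms(3)] by blast
  moreover have "length ys = k"
    using assms(2,3) mset_eq_length by metis
  ultimately show ?thesis
    using assms(1) by (auto simp: symmetric_tensor_def)
qed

lemma symmetric_tensor_Cons:
  assumes "symmetric_tensor (Suc k) A"
  shows "symmetric_tensor k (\<lambda>is. A (a # is))"
  unfolding symmetric_tensor_def
proof (intro allI impI)
  fix "is" :: "'a list" and \<sigma>
  assume "length is = k" "\<sigma> permutes {..<k}"
  then show "A (a # permute_list \<sigma> is) = A (a # is)"
    by (intro symmetric_tensor_mset[OF assms]) auto
qed

lemma nonneg_tensor_Cons:
  "nonneg_tensor (Suc k) A \<Longrightarrow> nonneg_tensor k (\<lambda>is. A (a # is))"
  by (auto simp: nonneg_tensor_def)

section \<open>Recursion of the form over the order\<close>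

lemma finite_lists_length: "finite {is :: 'n::finite list. length is = k}"
  using finite_lists_length_eq[of "UNIV :: 'n set" k] by simp

lemma sum_lists_Suc:
  fixes f :: "'n::finite list \<Rightarrow> real"
  shows "(\<Sum>is | length is = Suc k. f is) = (\<Sum>a\<in>UNIV. \<Sum>is | length is = k. f (a # is))"
proof -
  have "{is :: 'n list. length is = Suc k} = (\<lambda>(a, is). a # is) ` (UNIV \<times> {is. length is = k})"
    by (auto simp: length_Suc_conv image_iff)
  moreover have "inj_on (\<lambda>(a :: 'n, is). a # is) (UNIV \<times> {is. length is = k})"
    by (auto simp: inj_on_def)
  ultimately show ?thesis
    by (simp add: sum.reindex sum.cartesian_product finite_lists_length case_prod_unfold o_def)
qed

lemma tensor_form_0 [simp]: "tensor_form 0 A x = A []"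
  by (simp add: tensor_form_def)

text \<open>Drives the inductions on the order: fixing the first index leaves a tensor of order
  \<open>k\<close>, hence the generalization over \<open>A\<close>.\<close>

lemma tensor_form_Suc:
  "tensor_form (Suc k) A x = (\<Sum>a\<in>UNIV. x $ a * tensor_form k (\<lambda>is. A (a # is)) x)"
  by (simp add: tensor_form_def sum_lists_Suc sum_distrib_left mult_ac)

lemma tensor_apply_Suc:
  "tensor_apply (Suc k) A x $ i = tensor_form k (\<lambda>is. A (i # is)) x"
  by (simp add: tensor_apply_def tensor_form_def)

lemma tensor_form_scale: "tensor_form k A (c *\<^sub>R x) = c ^ k * tensor_form k A x"
proof (induction k arbitrary: A)
  case (Suc k)
  then show ?case
    by (simp add: tensor_form_Suc sum_distrib_left mult_ac)
qed simp

lemma continuous_on_tensor_form: "continuous_on S (tensor_form k A)"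
proof (induction k arbitrary: A)
  case 0
  then show ?case by simp
next
  case (Suc k)
  have "tensor_form (Suc k) A = (\<lambda>x. \<Sum>a\<in>UNIV. x $ a * tensor_form k (\<lambda>is. A (a # is)) x)"
    by (simp add: fun_eq_iff tensor_form_Suc)
  then show ?case
    by (simp only:) (intro continuous_intros Suc)
qed

lemma tensor_form_nonneg:
  assumes "nonneg_tensor k A" "\<And>i. 0 \<le> x $ i"
  shows "0 \<le> tensor_form k A x"
  using assms(1)
proof (induction k arbitrary: A)
  case 0
  then show ?case by (simp add: nonneg_tensor_def)
next
  case (Suc k)
  then show ?case
    by (simp add: tensor_form_Suc sum_nonneg assms(2) nonneg_tensor_Cons)
qed

text \<open>Triangle inequality, applied one index at a time; nonnegative entries equal their
  absolute values.\<close>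

lemma abs_tensor_form_le:
  assumes "nonneg_tensor k A"
  shows "\<bar>tensor_form k A x\<bar> \<le> tensor_form k A (\<chi> i. \<bar>x $ i\<bar>)"
  using assms
proof (induction k arbitrary: A)
  case 0
  then show ?case by (simp add: nonneg_tensor_def)
next
  case (Suc k)
  have "\<bar>tensor_form (Suc k) A x\<bar> \<le> (\<Sum>a\<in>UNIV. \<bar>x $ a * tensor_form k (\<lambda>is. A (a # is)) x\<bar>)"
    unfolding tensor_form_Suc by (rule sum_abs)
  also have "\<dots> \<le> tensor_form (Suc k) A (\<chi> i. \<bar>x $ i\<bar>)"
    unfolding tensor_form_Suc abs_mult
    by (auto intro!: sum_mono mult_left_mono Suc nonneg_tensor_Cons)
  finally show ?case .
qed

section \<open>Derivative along a coordinate axis\<close>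

text \<open>The induction peels off the first index: differentiating the factor \<open>x\<^sub>a\<close> yields one copy of
  the claimed vector, and in the remaining terms symmetry exchanges \<open>i\<close> with the peeled index.\<close>

lemma tensor_form_has_derivative_axis:
  assumes "symmetric_tensor k A"
  shows "((\<lambda>t. tensor_form k A (x + t *\<^sub>R axis i 1)) has_real_derivative
           real k * tensor_apply k A x $ i) (at 0)"
  using assms
proof (induction k arbitrary: A)
  case 0
  then show ?case by simp
next
  case (Suc k)
  define B where "B a = (\<lambda>is. A (a # is))" for a
  have sym: "symmetric_tensor k (B a)" for a
    unfolding B_def by (rule symmetric_tensor_Cons[OF Suc.prems])
  have "((\<lambda>t. \<Sum>a\<in>UNIV. (x $ a + t * axis i 1 $ a) * tensor_form k (B a) (x + t *\<^sub>R axis i 1))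
          has_real_derivative
          (\<Sum>a\<in>UNIV. axis i 1 $ a * tensor_form k (B a) x
                     + real k * tensor_apply k (B a) x $ i * x $ a)) (at 0)"
    by (rule derivative_eq_intros Suc.IH[OF sym] refl | simp)+
  moreover have "(\<Sum>a\<in>UNIV. axis i 1 $ a * tensor_form k (B a) x) = tensor_form k (B i) x"
    by (simp add: axis_def if_distrib[of "\<lambda>c. c * _"] cong: if_cong)
  moreover have "(\<Sum>a\<in>UNIV. real k * tensor_apply k (B a) x $ i * x $ a)
      = real k * tensor_form k (B i) x"
  \<comment> \<open>At order 0 the truncated \<open>k - 1\<close> makes \<open>tensor_apply\<close>
    meaningless, but the factor \<open>real k\<close> removes it.\<close>
  proof (cases k)
    case 0
    then show ?thesis by simp
  next
    case (Suc m)
    have "tensor_form m (\<lambda>is. B a (i # is)) x = tensor_form m (\<lambda>is. B i (a # is)) x" for a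
      unfolding tensor_form_def B_def
      using Suc by (intro sum.cong refl arg_cong2[where f = "(*)"]
          symmetric_tensor_mset[OF Suc.prems]) auto
    then show ?thesis
      by (simp add: Suc tensor_apply_Suc tensor_form_Suc sum_distrib_left mult_ac)
  qed
  ultimately show ?case
    by (simp add: tensor_form_Suc tensor_apply_Suc sum.distrib distrib_right flip: B_def)
qed

section \<open>Euler's identity and the constrained maximum\<close>

lemma tensor_form_eq_sum_apply:
  assumes "0 < k"
  shows "tensor_form k A x = (\<Sum>i\<in>UNIV. x $ i * tensor_apply k A x $ i)"
  using assms by (cases k) (simp_all add: tensor_form_Suc tensor_apply_Suc)

text \<open>Extreme value theorem: the constraint set is closed, and its coordinates lie between 0
  and 1.\<close>

lemma attained_maximum_tensor_form:
  fixes A :: "'n::finite tensor"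
  assumes "0 < k"
  obtains x :: "real ^ 'n" where "\<And>i. 0 \<le> x $ i" "(\<Sum>i\<in>UNIV. (x $ i) ^ k) = 1"
    and "\<And>y. (\<And>i. 0 \<le> y $ i) \<Longrightarrow> (\<Sum>i\<in>UNIV. (y $ i) ^ k) = 1 \<Longrightarrow>
           tensor_form k A y \<le> tensor_form k A x"
proof -
  define S where "S = {x :: real ^ 'n. (\<forall>i. 0 \<le> x $ i) \<and> (\<Sum>i\<in>UNIV. (x $ i) ^ k) = 1}"
  have "closed S"
    unfolding S_def
    by (intro closed_Collect_conj closed_Collect_all closed_Collect_le closed_Collect_eq
        continuous_intros)
  moreover have "x $ i \<le> 1" if "x \<in> S" for x i
  proof -
    have "(x $ i) ^ k \<le> 1 ^ k"
      using that member_le_sum[of i UNIV "\<lambda>i. (x $ i) ^ k"] by (auto simp: S_def)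
    then show ?thesis
      using power_le_imp_le_base[of "x $ i" "k - 1" 1] assms by simp
  qed
  then have "S \<subseteq> cbox 0 (\<chi> i. 1)"
    by (auto simp: S_def mem_box_cart)
  then have "bounded S"
    using bounded_cbox bounded_subset by blast
  \<comment> \<open>Any standard unit vector shows that \<open>S\<close> is nonempty.\<close>
  moreover have "axis undefined 1 \<in> S"
    using assms by (simp add: S_def axis_def if_distrib[of "\<lambda>c. c ^ k"] power_0_left cong: if_cong)
  ultimately obtain x where "x \<in> S" "\<forall>y\<in>S. tensor_form k A y \<le> tensor_form k A x"
    using continuous_attains_sup[OF _ _ continuous_on_tensor_form, of S k A]
    by (auto simp: compact_eq_bounded_closed)
  then show thesis
    by (intro that[of x]) (auto simp: S_def)
qed

lemma tensor_form_le_homogeneous: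
  fixes y :: "real ^ 'n::finite"
  assumes "0 < k" and nonneg: "\<And>i. 0 \<le> y $ i"
    and le: "\<And>y. (\<And>i. 0 \<le> y $ i) \<Longrightarrow> (\<Sum>i\<in>UNIV. (y $ i) ^ k) = 1 \<Longrightarrow> tensor_form k A y \<le> M"
  shows "tensor_form k A y \<le> M * (\<Sum>i\<in>UNIV. (y $ i) ^ k)"
proof (cases "y = 0")
  case True
  \<comment> \<open>Scaling by 0 shows that the form vanishes at the origin, because the degree is
    positive.\<close>
  then show ?thesis
    using tensor_form_scale[of k A 0 0] assms(1) by (simp add: power_0_left)
next
  case False
  define s where "s = (\<Sum>i\<in>UNIV. (y $ i) ^ k)"
  \<comment> \<open>The \<open>k\<close>-norm of \<open>y\<close>; dividing by it normalizes
    \<open>y\<close>, and homogeneity undoes the division.\<close>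
  define c where "c = root k s"
  obtain j where "y $ j \<noteq> 0"
    using False by (auto simp: vec_eq_iff)
  then have "0 < y $ j"
    using nonneg[of j] by simp
  then have "0 < s"
    unfolding s_def by (intro sum_pos2[of _ j]) (auto simp: nonneg)
  then have c: "0 < c" "c ^ k = s"
    using assms(1) by (auto simp: c_def)
  have "tensor_form k A (inverse c *\<^sub>R y) \<le> M"
  proof (rule le)
    show "(\<Sum>i\<in>UNIV. ((inverse c *\<^sub>R y) $ i) ^ k) = 1"
      using c \<open>0 < s\<close> by (simp add: power_mult_distrib power_inverse flip: sum_distrib_left s_def)
  qed (use c nonneg in simp)
  then show ?thesis
    using c \<open>0 < s\<close> by (simp add: tensor_form_scale field_simps flip: s_def)
qed

section \<open>Upper bound on H-eigenvalues\<close>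

lemma H_eigenvalue_le:
  fixes A :: "'n::finite tensor"
  assumes "0 < k" "nonneg_tensor k A" "H_eigenvalue k A \<mu>"
    and le: "\<And>y. (\<And>i. 0 \<le> y $ i) \<Longrightarrow> tensor_form k A y \<le> M * (\<Sum>i\<in>UNIV. (y $ i) ^ k)"
  shows "\<mu> \<le> M"
proof -
  obtain x where x: "x \<noteq> 0" "tensor_apply k A x = \<mu> *\<^sub>R vec_power x (k - 1)"
    using assms(3) by (auto simp: H_eigenvalue_def)
  obtain m where k: "k = Suc m"
    using assms(1) gr0_conv_Suc by blast
  define y where "y = (\<chi> i. \<bar>x $ i\<bar>)"
  have y_nonneg: "0 \<le> y $ i" for i
    by (simp add: y_def)
  have "\<mu> * (y $ i) ^ m \<le> tensor_apply k A y $ i" for i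
  proof -
    \<comment> \<open>Passing to \<open>\<bar>\<mu>\<bar>\<close> also covers negative
      \<mu>.\<close>
    have "\<mu> * (y $ i) ^ m \<le> \<bar>\<mu>\<bar> * \<bar>x $ i\<bar> ^ m"
      by (simp add: y_def mult_right_mono)
    also have "\<dots> = \<bar>tensor_apply k A x $ i\<bar>"
      using x(2) by (simp add: k vec_power_def abs_mult power_abs)
    also have "\<dots> \<le> tensor_apply k A y $ i"
      using assms(2) unfolding k tensor_apply_Suc y_def
      by (intro abs_tensor_form_le nonneg_tensor_Cons)
    finally show ?thesis .
  qed
  then have "(\<Sum>i\<in>UNIV. y $ i * (\<mu> * (y $ i) ^ m)) \<le> tensor_form k A y"
    unfolding tensor_form_eq_sum_apply[OF assms(1)]
    by (intro sum_mono mult_left_mono y_nonneg)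
  also have "\<dots> \<le> M * (\<Sum>i\<in>UNIV. (y $ i) ^ k)"
    by (intro le y_nonneg)
  finally have "\<mu> * (\<Sum>i\<in>UNIV. (y $ i) ^ k) \<le> M * (\<Sum>i\<in>UNIV. (y $ i) ^ k)"
    by (simp add: k sum_distrib_left mult_ac)
  moreover obtain j where "x $ j \<noteq> 0"
    using x(1) by (auto simp: vec_eq_iff)
  then have "0 < (\<Sum>i\<in>UNIV. (y $ i) ^ k)"
    by (intro sum_pos2[of _ j]) (auto simp: y_def)
  ultimately show ?thesis
    by simp
qed

section \<open>First-order conditions at a maximizer\<close>

lemma tensor_apply_maximizer:
  fixes A :: "'n::finite tensor"
  assumes k: "2 \<le> k" and A: "symmetric_tensor k A" "nonneg_tensor k A"
    and x_nonneg: "\<And>i. 0 \<le> x $ i"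
    and x_eq: "tensor_form k A x = M * (\<Sum>i\<in>UNIV. (x $ i) ^ k)"
    and le: "\<And>y. (\<And>i. 0 \<le> y $ i) \<Longrightarrow> tensor_form k A y \<le> M * (\<Sum>i\<in>UNIV. (y $ i) ^ k)"
  shows "tensor_apply k A x = M *\<^sub>R vec_power x (k - 1)"
proof -
  have "tensor_apply k A x $ i = M * (x $ i) ^ (k - 1)" for i
  proof -
    define g where "g t = tensor_form k A (x + t *\<^sub>R axis i 1)
      - M * (\<Sum>j\<in>UNIV. ((x + t *\<^sub>R axis i 1) $ j) ^ k)" for t
    define D where "D = real k * (tensor_apply k A x $ i - M * (x $ i) ^ (k - 1))"
    have "((\<lambda>t. \<Sum>j\<in>UNIV. (x $ j + t * axis i 1 $ j) ^ k) has_real_derivative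
        (\<Sum>j\<in>UNIV. real k * (x $ j) ^ (k - 1) * axis i 1 $ j)) (at 0)"
      by (rule derivative_eq_intros refl | simp add: mult_ac)+
    moreover have "(\<Sum>j\<in>UNIV. real k * (x $ j) ^ (k - 1) * axis i 1 $ j)
        = real k * (x $ i) ^ (k - 1)"
      by (simp add: axis_def if_distrib[of "\<lambda>c. _ * c"] cong: if_cong)
    ultimately have "((\<lambda>t. \<Sum>j\<in>UNIV. ((x + t *\<^sub>R axis i 1) $ j) ^ k) has_real_derivative
        real k * (x $ i) ^ (k - 1)) (at 0)"
      by simp
    from DERIV_diff[OF tensor_form_has_derivative_axis[OF A(1)] DERIV_cmult[OF this]]
    have deriv: "(g has_real_derivative D) (at 0)"
      unfolding g_def D_def by (simp add: algebra_simps)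
    have g_0: "g 0 = 0"
      by (simp add: g_def x_eq)
    \<comment> \<open>The bound on \<open>t\<close> keeps the \<open>i\<close>th coordinate of the
      perturbed vector nonnegative.\<close>
    have g_le: "g t \<le> 0" if "- (x $ i) \<le> t" for t
    proof -
      have "0 \<le> (x + t *\<^sub>R axis i 1) $ j" for j
        using that x_nonneg[of j] by (auto simp: axis_def)
      then show ?thesis
        using le[of "x + t *\<^sub>R axis i 1"] by (simp add: g_def)
    qed
    \<comment> \<open>Positive \<open>t\<close> is always admissible, so this half holds on the
      boundary too.\<close>
    have "D \<le> 0"
    proof (rule ccontr)
      assume "\<not> D \<le> 0"
      then obtain d where "0 < d" "\<forall>h>0. h < d \<longrightarrow> g 0 < g (0 + h)"
        using DERIV_pos_inc_right[OF deriv] by auto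
      then have "0 < g (d / 2)"
        using g_0 by simp
      moreover have "g (d / 2) \<le> 0"
        using \<open>0 < d\<close> x_nonneg[of i] by (intro g_le) simp
      ultimately show False by simp
    qed
    show ?thesis
    proof (cases "x $ i = 0")
      case True
      obtain m where m: "k = Suc m"
        using k by (cases k) auto
      have "tensor_apply k A x $ i \<le> 0"
        using \<open>D \<le> 0\<close> True k by (simp add: D_def mult_le_0_iff power_0_left)
      moreover have "0 \<le> tensor_apply k A x $ i"
        using A(2) x_nonneg by (simp add: m tensor_apply_Suc tensor_form_nonneg nonneg_tensor_Cons)
      ultimately show ?thesis
        using True k by (simp add: power_0_left)
    next
      case False
      have "0 \<le> D"
      proof (rule ccontr)
        assume "\<not> 0 \<le> D"
        then obtain d where d: "0 < d" "\<forall>h>0. h < d \<longrightarrow> g 0 < g (0 - h)"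
          using DERIV_neg_dec_left[OF deriv] by auto
        \<comment> \<open>A step to the left within the range of the derivative argument that does
          not make the \<open>i\<close>th coordinate negative.\<close>
        define h where "h = min (d / 2) (x $ i)"
        have "0 < h" "h < d" "h \<le> x $ i"
          using d(1) False x_nonneg[of i] by (auto simp: h_def)
        then have "0 < g (- h)"
          using d(2) g_0 by simp
        moreover have "g (- h) \<le> 0"
          using \<open>h \<le> x $ i\<close> by (intro g_le) simp
        ultimately show False by simp
      qed
      with \<open>D \<le> 0\<close> show ?thesis
        using k by (simp add: D_def)
    qed
  qed
  then show ?thesis
    by (simp add: vec_eq_iff vec_power_def)
qed

theorem theorem2:
  fixes k :: nat and A :: "'n::finite tensor"
  assumes "2 \<le> k"
    and "symmetric_tensor k A"
    and "nonneg_tensor k A"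
  shows "is_maximum {\<mu>. H_eigenvalue k A \<mu>} (lambda_max k A) \<and>
         is_maximum {tensor_form k A x | x. (\<forall>i. 0 \<le> x $ i) \<and> (\<Sum>i\<in>UNIV. (x $ i) ^ k) = 1}
           (lambda_max k A)"
proof -
  have k: "0 < k"
    using assms(1) by simp
  obtain x :: "real ^ 'n" where x: "\<And>i. 0 \<le> x $ i" "(\<Sum>i\<in>UNIV. (x $ i) ^ k) = 1"
    and max: "\<And>y. (\<And>i. 0 \<le> y $ i) \<Longrightarrow> (\<Sum>i\<in>UNIV. (y $ i) ^ k) = 1 \<Longrightarrow>
           tensor_form k A y \<le> tensor_form k A x"
    using attained_maximum_tensor_form[OF k] by blast
  define M where "M = tensor_form k A x"
  have le: "tensor_form k A y \<le> M * (\<Sum>i\<in>UNIV. (y $ i) ^ k)" if "\<And>i. 0 \<le> y $ i" for y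
    unfolding M_def using k that max by (rule tensor_form_le_homogeneous)
  have "tensor_apply k A x = M *\<^sub>R vec_power x (k - 1)"
    using assms x le by (intro tensor_apply_maximizer) (auto simp: M_def)
  moreover have "x \<noteq> 0"
    using x(2) k by (auto simp: power_0_left)
  ultimately have eigen: "H_eigenvalue k A M"
    by (auto simp: H_eigenvalue_def)
  have upper: "\<mu> \<le> M" if "H_eigenvalue k A \<mu>" for \<mu>
    using k assms(3) that le by (rule H_eigenvalue_le)
  have "lambda_max k A = M"
    unfolding lambda_max_def using eigen upper by (rule Greatest_equality)
  then show ?thesis
    using eigen upper x max by (auto simp: is_maximum_def M_def)
qed

end
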